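(* (1) For every motion $x = [r, t] \in \mathbb{M}$, with $\tilde t = [0,t]$, the dual quaternion $$\hat U(x) = U(r) + \frac{\epsilon}{2}\, U(r)\,\tilde t$$ is a unit dual quaternion, i.e. $\hat U(x) \in \hat{\mathbb{U}}$. (2) Conversely, for every unit dual quaternion $\hat q = \tilde q + \tilde q_d \epsilon \in \hat{\mathbb{U}}$, we have $R(\tilde q) \in \mathbb{S}$, and $\tilde T(\hat q) = 2 (\tilde q)^{-1} \tilde q_d$ is a vector quaternion, i.e. $\tilde T(\hat q) = [0, T(\hat q)]$ with $T(\hat q) \in \mathbb{V}$. Setting $M(\hat q) = [R(\tilde q), T(\hat q)]$, we have $M(\hat q) \in \mathbb{S} \times \mathbb{V} \subset \mathbb{M}$. (3) Furthermore, for every $x \in \mathbb{S} \times \mathbb{V}$ we have $M(\hat U(x)) = x$, and for every $\hat q = \tilde q + \tilde q_d \epsilon \in \hat{\mathbb{U}}$ with $\tilde q \neq -\tilde 1$ we have $\hat U(M(\hat q)) = \hat q$.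
   Context: Let $\mathbb{V} = \mathbb{R}^3$ and let $\mathbb{Q}$ be the set of real quaternions $\tilde q = [q_0,q_1,q_2,q_3] \in \mathbb{R}^4$ with the standard Hamilton product; write $\tilde q = [q_0, q]$ with $q = [q_1,q_2,q_3] \in \mathbb{V}$. The conjugate is $\tilde q^* = [q_0,-q_1,-q_2,-q_3]$, the magnitude is $|\tilde q| = \sqrt{q_0^2+q_1^2+q_2^2+q_3^2}$, $\tilde 1 = [1,0,0,0]$, $\tilde 0 = [0,0,0,0]$. A vector quaternion is a quaternion with $q_0 = 0$. $\mathbb{U} = \{\tilde q \in \mathbb{Q} : |\tilde q| = 1\}$ is the set of unit quaternions. Define $U : \mathbb{V} \to \mathbb{U}$ by $U(r) = \left[\cos\frac{\|r\|_2}{2}, \frac{r}{\|r\|_2}\sin\frac{\|r\|_2}{2}\right]$ if $r \neq 0$, and $U(0) = \tilde 1$. Define $R : \mathbb{U} \to \mathbb{V}$ by $R(\tilde q) = \frac{2\cos^{-1} q_0}{\sqrt{q_1^2+q_2^2+q_3^2}}[q_1,q_2,q_3]$ if $q_0^2 \neq 1$, and $R(\tilde q) = 0$ otherwise, where $\cos^{-1}$ takes values in $[0,\pi]$. Let $\mathbb{S} = \{ r \in \mathbb{V} : \|r\|_2^2 < 4\pi^2 \}$. A dual quaternion is $\hat q = \tilde q + \tilde q_d \epsilon$ with $\tilde q, \tilde q_d \in \mathbb{Q}$, where $\epsilon$ commutes with quaternions and $\epsilon^2 = 0$; thus $\hat p + \hat q = (\tilde p + \tilde q) + (\tilde p_d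 + \tilde q_d)\epsilon$ and $\hat p\hat q = \tilde p\tilde q + (\tilde p\tilde q_d + \tilde p_d\tilde q)\epsilon$. It is a unit dual quaternion if $|\tilde q| = 1$ and $\tilde q\tilde q_d^* + \tilde q_d\tilde q^* = \tilde 0$. $\hat{\mathbb{U}}$ denotes the set of unit dual quaternions. A motion is a vector $x = [r,t] \in \mathbb{R}^6$ with $r, t \in \mathbb{V}$; $\mathbb{M} = \mathbb{V} \times \mathbb{V}$ is the set of motions. *)

theory Defs
  imports "HOL-Analysis.Analysis"
begin

datatype quaternion = Quat (qRe: real) (qI: real) (qJ: real) (qK: real)

instantiation quaternion :: real_algebra_1
begin

definition zero_quaternion where "0 = Quat 0 0 0 0"

definition one_quaternion where "1 = Quat 1 0 0 0"

definition plus_quaternion where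
  "p + q = Quat (qRe p + qRe q) (qI p + qI q) (qJ p + qJ q) (qK p + qK q)"

definition uminus_quaternion where
  "- q = Quat (- qRe q) (- qI q) (- qJ q) (- qK q)"

definition minus_quaternion where
  "p - q = Quat (qRe p - qRe q) (qI p - qI q) (qJ p - qJ q) (qK p - qK q)"

definition scaleR_quaternion where
  "c *\<^sub>R q = Quat (c * qRe q) (c * qI q) (c * qJ q) (c * qK q)"

definition times_quaternion where
  "p * q = Quat
     (qRe p * qRe q - qI p * qI q - qJ p * qJ q - qK p * qK q)
     (qRe p * qI q + qI p * qRe q + qJ p * qK q - qK p * qJ q)
     (qRe p * qJ q - qI p * qK q + qJ p * qRe q + qK p * qI q)
     (qRe p * qK q + qI p * qJ q - qJ p * qI q + qK p * qRe q)"

lemmas quaternion_arith_defs =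
  zero_quaternion_def one_quaternion_def plus_quaternion_def uminus_quaternion_def
  minus_quaternion_def scaleR_quaternion_def times_quaternion_def

instance
  by standard (auto simp: quaternion_arith_defs algebra_simps)

end

instantiation quaternion :: real_div_algebra
begin

definition inverse_quaternion where
  "inverse q =
     (let n = (qRe q)\<^sup>2 + (qI q)\<^sup>2 + (qJ q)\<^sup>2 + (qK q)\<^sup>2
      in Quat (qRe q / n) (- qI q / n) (- qJ q / n) (- qK q / n))"

definition divide_quaternion where
  "p div q = p * inverse (q :: quaternion)"

instance
proof
  fix a :: quaternion
  let ?n = "(qRe a)\<^sup>2 + (qI a)\<^sup>2 + (qJ a)\<^sup>2 + (qK a)\<^sup>2"
  assume "a \<noteq> 0"
  then have "?n \<noteq> 0"
    by (cases a) (auto simp: zero_quaternion_def add_nonneg_eq_0_iff)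
  then show "inverse a * a = 1" "a * inverse a = 1"
    by (simp_all add: inverse_quaternion_def Let_def times_quaternion_def one_quaternion_def
        power2_eq_square flip: add_divide_distrib diff_divide_distrib)
qed (auto simp: inverse_quaternion_def divide_quaternion_def zero_quaternion_def)

end

definition qconj :: "quaternion \<Rightarrow> quaternion" where
  "qconj q = Quat (qRe q) (- qI q) (- qJ q) (- qK q)"

definition qmag :: "quaternion \<Rightarrow> real" where
  "qmag q = sqrt ((qRe q)\<^sup>2 + (qI q)\<^sup>2 + (qJ q)\<^sup>2 + (qK q)\<^sup>2)"

definition vector_quaternions :: "quaternion set" where
  "vector_quaternions = {q. qRe q = 0}"

definition quat_of :: "real \<Rightarrow> real ^ 3 \<Rightarrow> quaternion" where
  "quat_of s v = Quat s (v $ 1) (v $ 2) (v $ 3)"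

definition qvec :: "quaternion \<Rightarrow> real ^ 3" where
  "qvec q = vector [qI q, qJ q, qK q]"

text \<open>\<open>DQ q d\<close> stands for $q + d\,\epsilon$.\<close>

datatype dual_quaternion = DQ (std_part: quaternion) (dual_part: quaternion)

instantiation dual_quaternion :: real_algebra_1
begin

definition zero_dual_quaternion where "0 = DQ 0 0"

definition one_dual_quaternion where "1 = DQ 1 0"

definition plus_dual_quaternion where
  "p + q = DQ (std_part p + std_part q) (dual_part p + dual_part q)"

definition uminus_dual_quaternion where
  "- q = DQ (- std_part q) (- dual_part q)"

definition minus_dual_quaternion where
  "p - q = DQ (std_part p - std_part q) (dual_part p - dual_part q)"

definition scaleR_dual_quaternion where
  "c *\<^sub>R q = DQ (c *\<^sub>R std_part q) (c *\<^sub>R dual_part q)"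

definition times_dual_quaternion where
  "p * q = DQ (std_part p * std_part q)
              (std_part p * dual_part q + dual_part p * std_part q)"

lemmas dual_quaternion_arith_defs =
  zero_dual_quaternion_def one_dual_quaternion_def plus_dual_quaternion_def
  uminus_dual_quaternion_def minus_dual_quaternion_def scaleR_dual_quaternion_def
  times_dual_quaternion_def

instance
  by standard (auto simp: dual_quaternion_arith_defs algebra_simps)

end

definition dq_of_quat :: "quaternion \<Rightarrow> dual_quaternion" where
  "dq_of_quat q = DQ q 0"

definition dq_eps :: dual_quaternion where
  "dq_eps = DQ 0 1"

lemma DQ_eq: "DQ q d = dq_of_quat q + dq_of_quat d * dq_eps"
  by (simp add: dq_of_quat_def dq_eps_def dual_quaternion_arith_defs)

lemma dq_eps_commute: "dq_eps * dq_of_quat q = dq_of_quat q * dq_eps"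
  by (simp add: dq_of_quat_def dq_eps_def dual_quaternion_arith_defs)

lemma dq_eps_square: "dq_eps * dq_eps = 0"
  by (simp add: dq_eps_def dual_quaternion_arith_defs)

definition unit_dual_quaternions :: "dual_quaternion set" where
  "unit_dual_quaternions =
     {q. qmag (std_part q) = 1 \<and>
         std_part q * qconj (dual_part q) + dual_part q * qconj (std_part q) = 0}"

definition quat_of_rotvec :: "real ^ 3 \<Rightarrow> quaternion" where
  "quat_of_rotvec r =
     (if r = 0 then 1
      else quat_of (cos (norm r / 2)) (sin (norm r / 2) *\<^sub>R (r /\<^sub>R norm r)))"

text \<open>Meaningful only for \<open>qmag q = 1\<close>, where $q_0 \in [-1,1]$ and the denominator
  vanishes exactly if $q_0^2 = 1$.\<close>

definition rotvec_of_quat :: "quaternion \<Rightarrow> real ^ 3" where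
  "rotvec_of_quat q =
     (if (qRe q)\<^sup>2 \<noteq> 1
      then (2 * arccos (qRe q) / sqrt ((qI q)\<^sup>2 + (qJ q)\<^sup>2 + (qK q)\<^sup>2)) *\<^sub>R qvec q
      else 0)"

definition rotvec_ball :: "(real ^ 3) set" where
  "rotvec_ball = {r. (norm r)\<^sup>2 < 4 * pi\<^sup>2}"

text \<open>A motion $[r,t] \in \mathbb{R}^6$ is represented as a pair, so the set of motions is the whole type.\<close>

type_synonym motion = "(real ^ 3) \<times> (real ^ 3)"

definition dq_of_motion :: "motion \<Rightarrow> dual_quaternion" where
  "dq_of_motion x =
     (let r = fst x; t = snd x in
      dq_of_quat (quat_of_rotvec r)
      + (dq_eps /\<^sub>R 2) * dq_of_quat (quat_of_rotvec r) * dq_of_quat (quat_of 0 t))"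

definition trans_quat :: "dual_quaternion \<Rightarrow> quaternion" where
  "trans_quat q = 2 *\<^sub>R (inverse (std_part q) * dual_part q)"

definition trans_vec :: "dual_quaternion \<Rightarrow> real ^ 3" where
  "trans_vec q = qvec (trans_quat q)"

definition motion_of_dq :: "dual_quaternion \<Rightarrow> motion" where
  "motion_of_dq q = (rotvec_of_quat (std_part q), trans_vec q)"

end

theory Submission
  imports Defs
begin

text \<open>For a unit quaternion q the inverse is the conjugate, so the condition on a dual part d
  says that the real part of q^{-1} d vanishes (\<open>unit_dual_quaternions_iff\<close>). Hence the
  unit dual quaternions are exactly q + (q t / 2) \<epsilon> with q a unit and t a vector
  quaternion, and t = 2 q^{-1} d recovers the translation by cancellation. What remains is the
  rotation part, which is polar coordinates on the 3-sphere: a half angle and an axis. On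
  \<open>rotvec_ball\<close> the half angle is below \<pi>, where \<open>arccos\<close> inverts
  \<open>cos\<close> and the sine is nonnegative, so both round trips close
  (\<open>rotvec_of_quat_of_rotvec\<close>, \<open>quat_of_rotvec_of_quat\<close>). Only -1, with
  half angle \<pi> and no determined axis, is missed.\<close>

lemma quat_of_simps [simp]:
  "qRe (quat_of s v) = s" "qI (quat_of s v) = v $ 1"
  "qJ (quat_of s v) = v $ 2" "qK (quat_of s v) = v $ 3"
  by (simp_all add: quat_of_def)

lemma qvec_nth [simp]: "qvec q $ 1 = qI q" "qvec q $ 2 = qJ q" "qvec q $ 3 = qK q"
  by (simp_all add: qvec_def vector_3)

lemma quat_of_qRe_qvec [simp]: "quat_of (qRe q) (qvec q) = q"
  by (simp add: quat_of_def)

lemma qvec_quat_of [simp]: "qvec (quat_of s v) = v"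
  by (simp add: vec_eq_iff forall_3)

lemma vector_quaternion_eq: "q \<in> vector_quaternions \<longleftrightarrow> q = quat_of 0 (qvec q)"
  unfolding vector_quaternions_def by (cases q) (auto simp: quat_of_def)

lemma norm_squared_3: "(norm (v :: real ^ 3))\<^sup>2 = (v $ 1)\<^sup>2 + (v $ 2)\<^sup>2 + (v $ 3)\<^sup>2"
  unfolding power2_norm_eq_inner inner_vec_def by (simp add: sum_3 power2_eq_square)

lemma norm_qvec: "norm (qvec q) = sqrt ((qI q)\<^sup>2 + (qJ q)\<^sup>2 + (qK q)\<^sup>2)"
  using norm_squared_3[of "qvec q"] by (simp add: real_sqrt_unique)

lemma qmag_eq_1_iff: "qmag q = 1 \<longleftrightarrow> (qRe q)\<^sup>2 + (norm (qvec q))\<^sup>2 = 1"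
  by (simp add: qmag_def norm_squared_3 add.assoc)

lemma inverse_unit_quaternion: "qmag q = 1 \<Longrightarrow> inverse q = qconj q"
  by (simp add: inverse_quaternion_def qconj_def qmag_def)

lemma unit_quaternion_nonzero: "qmag q = 1 \<Longrightarrow> q \<noteq> 0"
  by (auto simp: qmag_def zero_quaternion_def)

text \<open>Both forms of the orthogonality condition say that the coordinate vectors of
  \<open>q\<close> and \<open>d\<close> are orthogonal in $\mathbb{R}^4$.\<close>

lemma unit_dual_quaternions_iff:
  "DQ q d \<in> unit_dual_quaternions \<longleftrightarrow> qmag q = 1 \<and> inverse q * d \<in> vector_quaternions"
  by (auto simp: unit_dual_quaternions_def vector_quaternions_def inverse_unit_quaternion
      qconj_def quaternion_arith_defs algebra_simps)

text \<open>Moving \<epsilon> to the right reduces every claim about motions to the two quaternion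
  components.\<close>

lemma dq_of_motion_eq:
  "dq_of_motion (r, t) = DQ (quat_of_rotvec r) ((quat_of_rotvec r * quat_of 0 t) /\<^sub>R 2)"
  by (simp add: dq_of_motion_def dq_of_quat_def dq_eps_def dual_quaternion_arith_defs)

lemma qmag_quat_of_rotvec: "qmag (quat_of_rotvec r) = 1"
proof (cases "r = 0")
  case True
  then show ?thesis by (simp add: quat_of_rotvec_def qmag_def one_quaternion_def)
next
  case False
  then show ?thesis
    by (simp add: quat_of_rotvec_def qmag_eq_1_iff power_mult_distrib field_simps)
qed

lemma dq_of_motion_unit: "dq_of_motion x \<in> unit_dual_quaternions"
proof (cases x)
  case (Pair r t)
  have "quat_of_rotvec r \<noteq> 0"
    by (rule unit_quaternion_nonzero[OF qmag_quat_of_rotvec])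
  then have "inverse (quat_of_rotvec r) * ((quat_of_rotvec r * quat_of 0 t) /\<^sub>R 2)
      = quat_of 0 t /\<^sub>R 2"
    by (simp flip: mult.assoc)
  then show ?thesis
    by (simp add: Pair dq_of_motion_eq unit_dual_quaternions_iff qmag_quat_of_rotvec
        vector_quaternions_def scaleR_quaternion_def)
qed

lemma trans_quat_vector:
  assumes "q \<in> unit_dual_quaternions"
  shows "trans_quat q \<in> vector_quaternions"
  using assms unit_dual_quaternions_iff[of "std_part q" "dual_part q"]
  by (simp add: trans_quat_def vector_quaternions_def scaleR_quaternion_def)

lemma trans_quat_dq_of_motion: "trans_quat (dq_of_motion (r, t)) = quat_of 0 t"
  using unit_quaternion_nonzero[OF qmag_quat_of_rotvec, of r]
  by (simp add: trans_quat_def dq_of_motion_eq flip: mult.assoc)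

lemma mem_rotvec_ball: "r \<in> rotvec_ball \<longleftrightarrow> norm r < 2 * pi"
proof -
  have "r \<in> rotvec_ball \<longleftrightarrow> (norm r)\<^sup>2 < (2 * pi)\<^sup>2"
    by (simp add: rotvec_ball_def power_mult_distrib)
  also have "\<dots> \<longleftrightarrow> norm r < 2 * pi"
    using power2_less_imp_less[of "norm r" "2 * pi"] power_strict_mono[of "norm r" "2 * pi" 2]
    by fastforce
  finally show ?thesis .
qed

text \<open>Angle times unit axis: norm and direction can be read off separately, as in
  \<open>quat_of_rotvec\<close>.\<close>

lemma rotvec_of_quat_eq:
  "rotvec_of_quat q = (if (qRe q)\<^sup>2 \<noteq> 1 then (2 * arccos (qRe q)) *\<^sub>R (qvec q /\<^sub>R norm (qvec q)) else 0)"
  by (simp add: rotvec_of_quat_def norm_qvec divide_inverse)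

text \<open>The axis is undefined only at the two poles of the sphere, where the vector part
  vanishes; elsewhere the strict bounds keep \<open>arccos\<close> off its endpoints 0 and
  \<pi>.\<close>

lemma unit_quaternion_cases:
  assumes "qmag q = 1"
  obtains "q = 1" | "q = - 1" | "(qRe q)\<^sup>2 \<noteq> 1" "- 1 < qRe q" "qRe q < 1" "qvec q \<noteq> 0"
proof (cases "(qRe q)\<^sup>2 = 1")
  case True
  with assms have "qvec q = 0"
    by (simp add: qmag_eq_1_iff)
  then have q: "q = quat_of (qRe q) 0"
    by (metis quat_of_qRe_qvec)
  from True have "qRe q = 1 \<or> qRe q = - 1"
    by (simp add: power2_eq_1_iff)
  then have "q = 1 \<or> q = - 1"
    using q by (auto simp: quat_of_def one_quaternion_def uminus_quaternion_def)
  with that(1,2) show thesis by blast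
next
  case False
  with assms have "qvec q \<noteq> 0" and "(qRe q)\<^sup>2 < 1"
    by (auto simp: qmag_eq_1_iff) (smt (verit) False zero_le_power2)
  with False that(3) show thesis
    by (auto simp: abs_square_less_1)
qed

text \<open>Away from the poles the norm is 2 \<open>arccos\<close> (\<open>qRe q\<close>) with
  \<open>arccos\<close> strictly below \<pi>. The pole -1 would give 2 \<pi>, but there the default
  value 0 applies.\<close>

lemma rotvec_of_quat_in_ball:
  assumes "qmag q = 1"
  shows "rotvec_of_quat q \<in> rotvec_ball"
  using assms
proof (cases rule: unit_quaternion_cases)
  case 3
  then show ?thesis
    using arccos_lt_bounded[of "qRe q"] by (simp add: rotvec_of_quat_eq mem_rotvec_ball)
qed (simp_all add: rotvec_of_quat_eq mem_rotvec_ball one_quaternion_def uminus_quaternion_def)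

lemma rotvec_of_quat_of_rotvec:
  assumes "r \<in> rotvec_ball"
  shows "rotvec_of_quat (quat_of_rotvec r) = r"
proof (cases "r = 0")
  case True
  then show ?thesis by (simp add: rotvec_of_quat_eq quat_of_rotvec_def one_quaternion_def)
next
  case False
  let ?h = "norm r / 2"
  have h: "0 < ?h" "?h < pi"
    using False assms by (simp_all add: mem_rotvec_ball)
  \<comment> \<open>Positivity excludes the default branch of \<open>rotvec_of_quat\<close>, and
    normalising the vector part then returns the axis without a sign change.\<close>
  then have s: "0 < sin ?h"
    by (rule sin_gt_zero)
  then have "(cos ?h)\<^sup>2 \<noteq> 1"
    by (simp add: cos_squared_eq)
  moreover have "arccos (cos ?h) = ?h"
    using h by (intro arccos_cos) auto
  ultimately show ?thesis
    using False s by (simp add: rotvec_of_quat_eq quat_of_rotvec_def field_simps)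
qed

text \<open>The exclusion of -1 is forced: \<open>rotvec_of_quat\<close> sends it to 0, which
  \<open>quat_of_rotvec\<close> sends to 1.\<close>

lemma quat_of_rotvec_of_quat:
  assumes "qmag q = 1" "q \<noteq> - 1"
  shows "quat_of_rotvec (rotvec_of_quat q) = q"
  using assms(1)
proof (cases rule: unit_quaternion_cases)
  case 1
  then show ?thesis by (simp add: rotvec_of_quat_eq quat_of_rotvec_def one_quaternion_def)
next
  case 2
  with assms(2) show ?thesis by simp
next
  case 3
  let ?a = "arccos (qRe q)"
  \<comment> \<open>A positive angle makes the rotation vector nonzero, so
    \<open>quat_of_rotvec\<close> takes its trigonometric branch.\<close>
  have a: "0 < ?a" "cos ?a = qRe q"
    using 3 arccos_lt_bounded[of "qRe q"] by simp_all
  \<comment> \<open>The sine of an \<open>arccos\<close> is the nonnegative root of this quantity,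
    so it restores the length of the vector part.\<close>
  have "(norm (qvec q))\<^sup>2 = 1 - (qRe q)\<^sup>2"
    using assms(1) by (simp add: qmag_eq_1_iff)
  then have "sin ?a = norm (qvec q)"
    using 3 by (simp add: sin_arccos real_sqrt_unique)
  then have "quat_of_rotvec (rotvec_of_quat q) = quat_of (qRe q) (qvec q)"
    using 3 a by (simp add: rotvec_of_quat_eq quat_of_rotvec_def field_simps)
  then show ?thesis by simp
qed

lemma motion_of_dq_of_motion:
  assumes "fst x \<in> rotvec_ball"
  shows "motion_of_dq (dq_of_motion x) = x"
  using assms
  by (cases x) (simp add: motion_of_dq_def trans_vec_def trans_quat_dq_of_motion,
      simp add: dq_of_motion_eq rotvec_of_quat_of_rotvec)

lemma dq_of_motion_of_dq:
  assumes "q \<in> unit_dual_quaternions" "std_part q \<noteq> - 1"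
  shows "dq_of_motion (motion_of_dq q) = q"
proof -
  have m: "qmag (std_part q) = 1"
    using assms(1) by (simp add: unit_dual_quaternions_def)
  \<comment> \<open>Passing to \<open>trans_vec\<close> drops the real part, which is 0 by the unit
    condition.\<close>
  have "quat_of 0 (trans_vec q) = trans_quat q"
    using trans_quat_vector[OF assms(1)] by (simp add: trans_vec_def vector_quaternion_eq)
  moreover have "(std_part q * trans_quat q) /\<^sub>R 2 = dual_part q"
    using unit_quaternion_nonzero[OF m] by (simp add: trans_quat_def flip: mult.assoc)
  ultimately show ?thesis
    by (simp add: motion_of_dq_def dq_of_motion_eq quat_of_rotvec_of_quat[OF m assms(2)])
qed

theorem theorem2p4:
  shows "(\<forall>x :: motion. dq_of_motion x \<in> unit_dual_quaternions) \<and>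
    (\<forall>q \<in> unit_dual_quaternions.
        rotvec_of_quat (std_part q) \<in> rotvec_ball \<and>
        trans_quat q \<in> vector_quaternions \<and>
        trans_quat q = quat_of 0 (trans_vec q) \<and>
        motion_of_dq q \<in> rotvec_ball \<times> UNIV) \<and>
    (\<forall>x \<in> rotvec_ball \<times> UNIV. motion_of_dq (dq_of_motion x) = x) \<and>
    (\<forall>q \<in> unit_dual_quaternions.
        std_part q \<noteq> - 1 \<longrightarrow> dq_of_motion (motion_of_dq q) = q)"
proof (intro conjI ballI allI impI)
  fix q assume q: "q \<in> unit_dual_quaternions"
  then show R: "rotvec_of_quat (std_part q) \<in> rotvec_ball"
    by (simp add: unit_dual_quaternions_def rotvec_of_quat_in_ball)
  show "trans_quat q \<in> vector_quaternions"
    using q by (rule trans_quat_vector)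
  then show "trans_quat q = quat_of 0 (trans_vec q)"
    by (simp add: trans_vec_def vector_quaternion_eq)
  show "motion_of_dq q \<in> rotvec_ball \<times> UNIV"
    using R by (simp add: motion_of_dq_def)
qed (auto intro: dq_of_motion_unit motion_of_dq_of_motion dq_of_motion_of_dq)

end
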